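(* Let $n,s$ be integers with $s\geq 2$ and $s\leq \frac{n}{2^{17}\log n}$. Let $\mathcal{F}\subset \Sigma_n$ be a family of permutations such that $\nu(\mathcal{F})<s$. Then $|\mathcal{F}|\leq (s-1)(n-1)!$. Moreover, in the case of equality, $\mathcal{F}$ is of the form $\bigcup_{i=1}^{s-1}\Sigma_n[(x,y_i)]$ or $\bigcup_{i=1}^{s-1}\Sigma_n[(x_i,y)]$, where the $y_i$'s, respectively the $x_i$'s, are distinct elements of $[n]$ (and $x$, respectively $y$, is some element of $[n]$).
   Context: $\Sigma_n$ denotes the set of all permutations $[n]\to[n]$. A permutation $\sigma$ is identified with its graph $\{(i,\sigma(i)):i\in[n]\}\subset[n]^2$; two permutations intersect iff they agree at some point. $\nu(\mathcal{F})$ is the maximum number of pairwise disjoint (non-intersecting) permutations in $\mathcal{F}$. For a pair $(x,y)\in[n]^2$, $\Sigma_n[(x,y)]$ is the set of permutations $\pi\in\Sigma_n$ with $\pi(x)=y$. *)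

theory Defs
  imports Complex_Main "HOL-Combinatorics.Permutations"
begin

definition Sym :: "nat \<Rightarrow> (nat \<Rightarrow> nat) set" where
  "Sym n = {\<sigma>. \<sigma> permutes {1..n}}"

definition intersect :: "nat \<Rightarrow> (nat \<Rightarrow> nat) \<Rightarrow> (nat \<Rightarrow> nat) \<Rightarrow> bool" where
  "intersect n \<sigma> \<tau> \<longleftrightarrow> (\<exists>i\<in>{1..n}. \<sigma> i = \<tau> i)"

definition nu :: "nat \<Rightarrow> (nat \<Rightarrow> nat) set \<Rightarrow> nat" where
  "nu n F = Max {card G | G. G \<subseteq> F \<and>
     (\<forall>\<sigma>\<in>G. \<forall>\<tau>\<in>G. \<sigma> \<noteq> \<tau> \<longrightarrow> \<not> intersect n \<sigma> \<tau>)}"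

definition Star :: "nat \<Rightarrow> nat \<Rightarrow> nat \<Rightarrow> (nat \<Rightarrow> nat) set" where
  "Star n x y = {\<pi> \<in> Sym n. \<pi> x = y}"

end

theory Submission
  imports Defs
begin

text \<open>
  Call \<open>n\<close> pairwise disjoint permutations a Latin square. It contains at most \<open>nu n F\<close> members of
  \<open>F\<close>, and so do its translates; averaging over the translates gives the bound. If the bound is
  attained, every Latin square contains exactly \<open>nu n F\<close> members of \<open>F\<close>. Two disjoint
  permutations extend to a Latin square by Hall's theorem, and the added permutations also complete
  any other two permutations with the same union. Hence the indicator \<open>f\<close> of \<open>F\<close> satisfies
  \<open>f (\<sigma> q) - f (\<sigma> q p) = f \<sigma> - f (\<sigma> p)\<close> for derangements \<open>p\<close>, \<open>q\<close> of complementary sets.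
  A permutation of at least four points is a product of two derangements, so here \<open>q\<close> may be
  arbitrary. For a transposition \<open>p = (i j)\<close> this says that \<open>f \<sigma> - f (\<sigma> p)\<close> depends on \<open>\<sigma> i\<close> and
  \<open>\<sigma> j\<close> only, and it turns out to be a mixed second difference of a matrix indexed by positions
  and values. Because \<open>f\<close> is Boolean, any two nonzero mixed differences share a row or a column,
  which forces all of them into a common row or a common column: \<open>f \<sigma>\<close> depends on a
  single \<open>\<sigma> x\<close> or on a single \<open>inv \<sigma> y\<close>.
\<close>

section \<open>Hall's theorem\<close>

definition hall_condition :: "'a set \<Rightarrow> ('a \<Rightarrow> 'b set) \<Rightarrow> bool" where
  "hall_condition A N \<longleftrightarrow> (\<forall>J\<subseteq>A. card J \<le> card (\<Union>(N ` J)))"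

lemma hall_conditionD: "hall_condition A N \<Longrightarrow> J \<subseteq> A \<Longrightarrow> card J \<le> card (\<Union>(N ` J))"
  by (simp add: hall_condition_def)

lemma not_hall_condition_updE:
  assumes hall: "hall_condition A N"
    and violated: "\<not> hall_condition A (N(a := M))"
  obtains J where "J \<subseteq> A" "a \<in> J" "card (\<Union>((N(a := M)) ` J)) < card J"
proof -
  obtain J where J: "J \<subseteq> A" "card (\<Union>((N(a := M)) ` J)) < card J"
    using violated unfolding hall_condition_def by (meson not_le)
  have "\<not> card (\<Union>(N ` J)) < card J" using hall_conditionD[OF hall J(1)] by simp
  then have "a \<in> J" using J(2) by (metis fun_upd_image)
  then show thesis using that J by blast
qed

text \<open>Rado's argument: two violating sets, one for each removal, would contradict the
  submodularity of \<open>J \<mapsto> card (\<Union>(N ` J))\<close>.\<close>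
lemma hall_condition_remove_element:
  assumes fin: "finite A" "\<And>b. b \<in> A \<Longrightarrow> finite (N b)"
    and hall: "hall_condition A N" and neq: "x \<noteq> y"
  shows "hall_condition A (N(a := N a - {x})) \<or> hall_condition A (N(a := N a - {y}))"
proof (rule ccontr)
  assume "\<not> ?thesis"
  then have violated: "\<not> hall_condition A (N(a := N a - {x}))"
    "\<not> hall_condition A (N(a := N a - {y}))" by auto
  from not_hall_condition_updE[OF hall violated(1)]
  obtain J where J: "J \<subseteq> A" "a \<in> J" "card (\<Union>((N(a := N a - {x})) ` J)) < card J" by blast
  from not_hall_condition_updE[OF hall violated(2)]
  obtain K where K: "K \<subseteq> A" "a \<in> K" "card (\<Union>((N(a := N a - {y})) ` K)) < card K" by blast
  define X Y where "X = \<Union>((N(a := N a - {x})) ` J)" and "Y = \<Union>((N(a := N a - {y})) ` K)"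
  have finJK: "finite J" "finite K" using J(1) K(1) fin(1) finite_subset by blast+
  have "finite (N b)" if "b \<in> J \<union> K" for b using that J(1) K(1) fin(2) by blast
  then have finXY: "finite X" "finite Y" using finJK unfolding X_def Y_def by auto
  have "X \<union> Y = \<Union>(N ` (J \<union> K))"
    using J(2) K(2) neq unfolding X_def Y_def by (auto split: if_splits)
  moreover have "J \<union> K \<subseteq> A" using J(1) K(1) by blast
  ultimately have union: "card (J \<union> K) \<le> card (X \<union> Y)" using hall_conditionD[OF hall] by metis
  have "card (J \<inter> K - {a}) \<le> card (\<Union>(N ` (J \<inter> K - {a})))"
    using J(1) by (intro hall_conditionD[OF hall]) blast
  also have "\<dots> \<le> card (X \<inter> Y)"
    using finXY unfolding X_def Y_def by (intro card_mono) auto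
  finally have inter: "card (J \<inter> K) - 1 \<le> card (X \<inter> Y)"
    using J(2) K(2) by simp
  have "card X + card Y = card (X \<union> Y) + card (X \<inter> Y)"
    using finXY by (rule card_Un_Int)
  moreover have "card J + card K = card (J \<union> K) + card (J \<inter> K)"
    using finJK by (rule card_Un_Int)
  ultimately show False
    using union inter J(3) K(3) unfolding X_def Y_def by linarith
qed

lemma inj_on_if_hall_condition_singletons:
  assumes hall: "hall_condition A N" and singleton: "\<And>a. a \<in> A \<Longrightarrow> N a = {f a}"
  shows "inj_on f A"
proof (rule inj_onI, rule ccontr)
  fix a b assume "a \<in> A" "b \<in> A" "f a = f b" "a \<noteq> b"
  then show False using hall_conditionD[OF hall, of "{a, b}"] singleton by simp
qed

lemma hall_marriage:
  fixes N :: "'a \<Rightarrow> 'b set"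
  assumes "finite A" "\<And>a. a \<in> A \<Longrightarrow> finite (N a)" "hall_condition A N"
  shows "\<exists>f. inj_on f A \<and> (\<forall>a\<in>A. f a \<in> N a)"
  using assms(2,3)
proof (induction "\<Sum>a\<in>A. card (N a)" arbitrary: N rule: less_induct)
  case less
  note finN = less.prems(1) and hall = less.prems(2)
  show ?case
  proof (cases "\<exists>a\<in>A. \<exists>x\<in>N a. \<exists>y\<in>N a. x \<noteq> y")
    case True
    then obtain a x y where a: "a \<in> A" and xy: "x \<in> N a" "y \<in> N a" "x \<noteq> y" by blast
    obtain z where z: "z \<in> N a" "hall_condition A (N(a := N a - {z}))"
      using hall_condition_remove_element[OF assms(1) finN hall xy(3)] xy(1,2) by blast
    let ?N = "N(a := N a - {z})"
    have decreasing: "(\<Sum>b\<in>A. card (?N b)) < (\<Sum>b\<in>A. card (N b))"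
    proof (rule sum_strict_mono_ex1[OF assms(1)])
      show "\<forall>b\<in>A. card (?N b) \<le> card (N b)" using finN by (auto intro: card_mono)
      show "\<exists>b\<in>A. card (?N b) < card (N b)"
        using a card_Diff1_less[OF finN[OF a] z(1)] by (metis fun_upd_same)
    qed
    have "finite (?N b)" if "b \<in> A" for b using finN[OF that] by auto
    from less.hyps[OF decreasing this z(2)]
    obtain f where f: "inj_on f A" "\<forall>b\<in>A. f b \<in> ?N b" by blast
    have "?N b \<subseteq> N b" for b by simp
    then show ?thesis using f by blast
  next
    case False
    have "\<exists>b. N a = {b}" if "a \<in> A" for a
    proof -
      have "N a \<noteq> {}" using hall_conditionD[OF hall, of "{a}"] that by auto
      then show ?thesis using False that by blast
    qed
    then obtain f where f: "\<And>a. a \<in> A \<Longrightarrow> N a = {f a}" by metis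
    then show ?thesis using inj_on_if_hall_condition_singletons[OF hall f] by blast
  qed
qed

lemma ex_permutes_if_hall:
  assumes fin: "finite S"
    and hall: "\<And>J. J \<subseteq> S \<Longrightarrow> card J \<le> card {y \<in> S. \<exists>x\<in>J. R x y}"
  shows "\<exists>p. p permutes S \<and> (\<forall>x\<in>S. R x (p x))"
proof -
  have "(\<Union>x\<in>J. {y \<in> S. R x y}) = {y \<in> S. \<exists>x\<in>J. R x y}" for J by auto
  then have "hall_condition S (\<lambda>x. {y \<in> S. R x y})"
    using hall by (simp add: hall_condition_def)
  then obtain f where f: "inj_on f S" "\<forall>x\<in>S. f x \<in> S \<and> R x (f x)"
    using hall_marriage[OF fin, of "\<lambda>x. {y \<in> S. R x y}"] fin by auto
  have "restrict_id f S permutes S"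
    using f fin by (intro inj_imp_permutes) (auto simp: inj_on_def restrict_id_def)
  then show ?thesis using f(2) by (intro exI[of _ "restrict_id f S"]) simp
qed

lemma ex_permutes_avoiding:
  assumes fin: "finite S"
    and row: "\<And>x. x \<in> S \<Longrightarrow> card {y \<in> S. R x y} \<le> k"
    and col: "\<And>y. y \<in> S \<Longrightarrow> card {x \<in> S. R x y} \<le> k"
    and card: "2 * k \<le> card S"
  shows "\<exists>p. p permutes S \<and> (\<forall>x\<in>S. \<not> R x (p x))"
proof (rule ex_permutes_if_hall[OF fin])
  fix J assume J: "J \<subseteq> S"
  let ?M = "{y \<in> S. \<exists>x\<in>J. \<not> R x y}"
  consider (empty) "J = {}" | (small) x where "x \<in> J" "card J \<le> card S - k"
    | (large) "card S - k < card J" by fastforce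
  then show "card J \<le> card ?M"
  proof cases
    case (small x)
    have "card S - card {y \<in> S. R x y} \<le> card (S - {y \<in> S. R x y})"
      by (rule diff_card_le_card_Diff) (use fin in simp)
    also have "\<dots> \<le> card ?M" using fin small(1) by (intro card_mono) auto
    finally show ?thesis using row[of x] J small by (auto simp: subset_iff)
  next
    case large
    have "\<exists>x\<in>J. \<not> R x y" if "y \<in> S" for y
    proof (rule ccontr)
      assume "\<not> ?thesis"
      then have "card J \<le> card {x \<in> S. R x y}" using J fin by (intro card_mono) auto
      then show False using col[OF that] card large by linarith
    qed
    then have "?M = S" by blast
    then show ?thesis using J fin by (simp add: card_mono)
  qed simp
qed

lemma regular_relation_ex_permutes:
  assumes fin: "finite S" and k: "k > 0"
    and row: "\<And>x. x \<in> S \<Longrightarrow> card {y \<in> S. R x y} = k"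
    and col: "\<And>y. y \<in> S \<Longrightarrow> card {x \<in> S. R x y} = k"
  shows "\<exists>p. p permutes S \<and> (\<forall>x\<in>S. R x (p x))"
proof (rule ex_permutes_if_hall[OF fin])
  fix J assume J: "J \<subseteq> S"
  define M where "M = {y \<in> S. \<exists>x\<in>J. R x y}"
  have finJM: "finite J" "finite M" using J fin finite_subset by (auto simp: M_def)
  have "card J * k = (\<Sum>x\<in>J. card {y \<in> M. R x y})"
  proof -
    have "{y \<in> M. R x y} = {y \<in> S. R x y}" if "x \<in> J" for x using that by (auto simp: M_def)
    then show ?thesis using row J by (simp add: subset_iff)
  qed
  also have "\<dots> = (\<Sum>y\<in>M. card {x \<in> J. R x y})"
    using finJM by (intro sum_multicount_gen) auto
  also have "\<dots> \<le> (\<Sum>y\<in>M. k)"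
  proof (rule sum_mono)
    fix y assume "y \<in> M"
    then show "card {x \<in> J. R x y} \<le> k"
      using J fin col[of y] card_mono[of "{x \<in> S. R x y}" "{x \<in> J. R x y}"] by (auto simp: M_def)
  qed
  finally show "card J \<le> card {y \<in> S. \<exists>x\<in>J. R x y}" using k by (simp add: M_def)
qed

section \<open>Latin squares\<close>

definition pointwise_disjoint :: "'a set \<Rightarrow> ('a \<Rightarrow> 'b) set \<Rightarrow> bool" where
  "pointwise_disjoint S L \<longleftrightarrow> (\<forall>x\<in>S. inj_on (\<lambda>p. p x) L)"

definition latin_rectangle :: "'a set \<Rightarrow> ('a \<Rightarrow> 'a) set \<Rightarrow> bool" where
  "latin_rectangle S L \<longleftrightarrow> finite L \<and> (\<forall>p\<in>L. p permutes S) \<and> pointwise_disjoint S L"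

definition latin_square :: "'a set \<Rightarrow> ('a \<Rightarrow> 'a) set \<Rightarrow> bool" where
  "latin_square S L \<longleftrightarrow> latin_rectangle S L \<and> card L = card S"

lemma pointwise_disjoint_subset:
  "pointwise_disjoint S L \<Longrightarrow> M \<subseteq> L \<Longrightarrow> pointwise_disjoint S M"
  unfolding pointwise_disjoint_def by (meson inj_on_subset)

lemma latin_rectangleD:
  assumes "latin_rectangle S L"
  shows "finite L" "p \<in> L \<Longrightarrow> p permutes S" "x \<in> S \<Longrightarrow> inj_on (\<lambda>p. p x) L"
  using assms by (auto simp: latin_rectangle_def pointwise_disjoint_def)

lemma latin_rectangle_empty: "latin_rectangle S {}"
  by (simp add: latin_rectangle_def pointwise_disjoint_def)

lemma latin_rectangle_Un:
  assumes P: "latin_rectangle S P" and Q: "latin_rectangle S Q"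
    and disj: "\<And>p q x. p \<in> P \<Longrightarrow> q \<in> Q \<Longrightarrow> x \<in> S \<Longrightarrow> p x \<noteq> q x"
  shows "latin_rectangle S (P \<union> Q)"
proof -
  have "inj_on (\<lambda>p. p x) (P \<union> Q)" if "x \<in> S" for x
    using latin_rectangleD(3)[OF P that] latin_rectangleD(3)[OF Q that] disj that
    unfolding inj_on_Un by blast
  then show ?thesis
    using P Q by (auto simp: latin_rectangle_def pointwise_disjoint_def)
qed

lemma latin_rectangle_column:
  assumes "latin_rectangle S L" "x \<in> S"
  shows "(\<lambda>p. p x) ` L \<subseteq> S" "card ((\<lambda>p. p x) ` L) = card L"
  using latin_rectangleD(2,3)[OF assms(1)] assms(2) permutes_in_image
  by (fastforce, simp add: card_image)

lemma permutes_eq_inv_iff: "p permutes S \<Longrightarrow> x = inv p y \<longleftrightarrow> y = p x"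
  by (metis permutes_inv_eq)

lemma regular_relation_factorization:
  assumes fin: "finite S" and ne: "S \<noteq> {}"
    and row: "\<And>x. x \<in> S \<Longrightarrow> card {y \<in> S. R x y} = k"
    and col: "\<And>y. y \<in> S \<Longrightarrow> card {x \<in> S. R x y} = k"
  shows "\<exists>L. latin_rectangle S L \<and> card L = k \<and> (\<forall>p\<in>L. \<forall>x\<in>S. R x (p x))"
  using row col
proof (induction k arbitrary: R)
  case 0
  then show ?case using latin_rectangle_empty by (intro exI[of _ "{}"]) auto
next
  case (Suc k)
  obtain p where p: "p permutes S" "\<forall>x\<in>S. R x (p x)"
    using regular_relation_ex_permutes[OF fin _ Suc.prems] by auto
  have "\<exists>L. latin_rectangle S L \<and> card L = k \<and> (\<forall>q\<in>L. \<forall>x\<in>S. R x (q x) \<and> q x \<noteq> p x)"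
  proof (rule Suc.IH)
    fix x assume x: "x \<in> S"
    have "{y \<in> S. R x y \<and> y \<noteq> p x} = {y \<in> S. R x y} - {p x}" by auto
    then show "card {y \<in> S. R x y \<and> y \<noteq> p x} = k"
      using Suc.prems(1)[OF x] p x by (simp add: permutes_in_image)
  next
    fix y assume y: "y \<in> S"
    have inS: "inv p y \<in> S" using p(1) y by (meson permutes_in_image permutes_inv)
    moreover have "R (inv p y) y" using p inS by (metis permutes_inverses(1))
    moreover have "{x \<in> S. R x y \<and> y \<noteq> p x} = {x \<in> S. R x y} - {inv p y}"
      by (auto simp: permutes_eq_inv_iff[OF p(1)] permutes_inverses(1)[OF p(1)])
    ultimately show "card {x \<in> S. R x y \<and> y \<noteq> p x} = k"
      using Suc.prems(2)[OF y] by simp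
  qed
  then obtain L where L: "latin_rectangle S L" "card L = k"
    "\<And>q x. q \<in> L \<Longrightarrow> x \<in> S \<Longrightarrow> R x (q x) \<and> q x \<noteq> p x" by blast
  have "latin_rectangle S {p}"
    using p(1) by (simp add: latin_rectangle_def pointwise_disjoint_def)
  from latin_rectangle_Un[OF this L(1)] have "latin_rectangle S (insert p L)"
    using L(3) by fastforce
  moreover have "p \<notin> L" using L(3) ne by blast
  ultimately show ?case
    using L p(2) latin_rectangleD(1)[OF L(1)] by (intro exI[of _ "insert p L"]) auto
qed

lemma latin_rectangle_complement:
  assumes fin: "finite S" and ne: "S \<noteq> {}" and P: "latin_rectangle S P"
  shows "\<exists>Q. latin_rectangle S Q \<and> card Q = card S - card P
    \<and> (\<forall>q\<in>Q. \<forall>x\<in>S. q x \<notin> (\<lambda>p. p x) ` P)"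
proof (rule regular_relation_factorization[OF fin ne])
  fix x assume "x \<in> S"
  then show "card {y \<in> S. y \<notin> (\<lambda>p. p x) ` P} = card S - card P"
    using latin_rectangle_column[OF P] latin_rectangleD(1)[OF P]
    by (simp add: set_diff_eq[symmetric] card_Diff_subset)
next
  note finP = latin_rectangleD(1)[OF P] and perm = latin_rectangleD(2)[OF P]
  fix y assume y: "y \<in> S"
  have inS: "inv p y \<in> S" if "p \<in> P" for p
    using permutes_in_image[OF permutes_inv[OF perm[OF that]]] y by simp
  have "inj_on (\<lambda>p. inv p y) P"
  proof (rule inj_onI)
    fix p q assume pq: "p \<in> P" "q \<in> P" "inv p y = inv q y"
    then have "p (inv p y) = q (inv p y)" using perm by (metis permutes_inverses(1))
    then show "p = q" using latin_rectangleD(3)[OF P inS] pq by (auto dest: inj_onD)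
  qed
  then have "card ((\<lambda>p. inv p y) ` P) = card P" by (rule card_image)
  moreover have "{x \<in> S. y \<notin> (\<lambda>p. p x) ` P} = S - (\<lambda>p. inv p y) ` P"
    by (simp add: set_diff_eq image_iff permutes_eq_inv_iff[OF perm] cong: ball_cong)
  moreover have "(\<lambda>p. inv p y) ` P \<subseteq> S" using inS by blast
  ultimately show "card {x \<in> S. y \<notin> (\<lambda>p. p x) ` P} = card S - card P"
    using finP by (simp add: card_Diff_subset)
qed

lemma finite_latin_square: "latin_square S L \<Longrightarrow> finite L"
  by (simp add: latin_square_def latin_rectangle_def)

lemma ex_latin_square:
  assumes "finite S" "S \<noteq> {}"
  shows "\<exists>L. latin_square S L"
  using latin_rectangle_complement[OF assms latin_rectangle_empty] by (auto simp: latin_square_def)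

lemma latin_square_Un_complement:
  assumes fin: "finite S" and ne: "S \<noteq> {}"
    and P: "latin_rectangle S P" and Q: "latin_rectangle S Q" "card Q = card S - card P"
    and off: "\<And>q x. q \<in> Q \<Longrightarrow> x \<in> S \<Longrightarrow> q x \<notin> (\<lambda>p. p x) ` P"
  shows "latin_square S (P \<union> Q)" "P \<inter> Q = {}"
proof -
  obtain x where x: "x \<in> S" using ne by blast
  show disj: "P \<inter> Q = {}" using off x by blast
  have "card P \<le> card S"
    using card_mono[OF fin latin_rectangle_column(1)[OF P x]] latin_rectangle_column(2)[OF P x]
    by simp
  then have "card (P \<union> Q) = card S"
    using disj Q(2) latin_rectangleD(1)[OF P] latin_rectangleD(1)[OF Q(1)]
    by (simp add: card_Un_disjoint)
  moreover have "latin_rectangle S (P \<union> Q)"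
  proof (rule latin_rectangle_Un[OF P Q(1)])
    show "p x \<noteq> q x" if "p \<in> P" "q \<in> Q" "x \<in> S" for p q x
      using off[OF that(2,3)] that(1) by (metis imageI)
  qed
  ultimately show "latin_square S (P \<union> Q)" by (simp add: latin_square_def)
qed

definition latin_constant :: "'a set \<Rightarrow> (('a \<Rightarrow> 'a) \<Rightarrow> 'b::comm_monoid_add) \<Rightarrow> bool" where
  "latin_constant S f \<longleftrightarrow> (\<forall>L L'. latin_square S L \<longrightarrow> latin_square S L' \<longrightarrow> sum f L = sum f L')"

text \<open>The complement of a Latin rectangle depends only on its columns, so it completes both
  sides of the trade.\<close>
lemma sum_latin_trade:
  fixes f :: "('a \<Rightarrow> 'a) \<Rightarrow> 'b::ab_group_add"
  assumes const: "latin_constant S f" and fin: "finite S" and ne: "S \<noteq> {}"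
    and P: "latin_rectangle S P" and P': "latin_rectangle S P'"
    and columns: "\<And>x. x \<in> S \<Longrightarrow> (\<lambda>p. p x) ` P = (\<lambda>p. p x) ` P'"
  shows "sum f P = sum f P'"
proof -
  obtain Q where Q: "latin_rectangle S Q" "card Q = card S - card P"
    "\<And>q x. q \<in> Q \<Longrightarrow> x \<in> S \<Longrightarrow> q x \<notin> (\<lambda>p. p x) ` P"
    using latin_rectangle_complement[OF fin ne P] by blast
  obtain x where x: "x \<in> S" using ne by blast
  have "card P' = card P"
    using columns[OF x] latin_rectangle_column(2)[OF P x] latin_rectangle_column(2)[OF P' x] by simp
  then have Q': "card Q = card S - card P'" "\<And>q x. q \<in> Q \<Longrightarrow> x \<in> S \<Longrightarrow> q x \<notin> (\<lambda>p. p x) ` P'"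
    using Q(2,3) columns by auto
  note finite = latin_rectangleD(1)[OF P] latin_rectangleD(1)[OF P'] latin_rectangleD(1)[OF Q(1)]
  note square = latin_square_Un_complement[OF fin ne P Q(1,2)]
    and square' = latin_square_Un_complement[OF fin ne P' Q(1) Q'(1)]
  have "sum f P + sum f Q = sum f (P \<union> Q)"
    using square(2) Q(3) finite by (simp add: sum.union_disjoint)
  also have "\<dots> = sum f (P' \<union> Q)"
    using square(1) square'(1) Q(3) Q'(2) const unfolding latin_constant_def by blast
  also have "\<dots> = sum f P' + sum f Q"
    using square'(2) Q'(2) finite by (simp add: sum.union_disjoint)
  finally show ?thesis by simp
qed

section \<open>Exchange of permutations with disjoint supports\<close>

definition derangement :: "'a set \<Rightarrow> ('a \<Rightarrow> 'a) \<Rightarrow> bool" where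
  "derangement S p \<longleftrightarrow> p permutes S \<and> (\<forall>x\<in>S. p x \<noteq> x)"

lemma ex_permutes_eq_comp_derangements:
  assumes p: "p permutes S" and card: "4 \<le> card S"
  shows "\<exists>q r. derangement S q \<and> derangement S r \<and> p = q \<circ> r"
proof -
  have fin: "finite S" using card by (intro card_ge_0_finite) simp
  have two: "card A \<le> 2" if "A \<subseteq> {x, y}" for A and x y :: 'a
    using card_mono[OF _ that] card_insert_le_m1[of 2 "{y}" x] by simp
  have "\<exists>r. r permutes S \<and> (\<forall>x\<in>S. \<not> (r x = x \<or> r x = p x))"
  proof (rule ex_permutes_avoiding[OF fin])
    show "card {y \<in> S. y = x \<or> y = p x} \<le> 2" for x by (rule two[of _ x "p x"]) auto
    show "card {x \<in> S. y = x \<or> y = p x} \<le> 2" for y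
      by (rule two[of _ y "inv p y"]) (auto simp: permutes_eq_inv_iff[OF p])
  qed (use card in simp)
  then obtain r where r: "r permutes S" "\<And>x. x \<in> S \<Longrightarrow> r x \<noteq> x \<and> r x \<noteq> p x" by blast
  have "derangement S (p \<circ> inv r)" unfolding derangement_def
  proof (intro conjI ballI)
    show "p \<circ> inv r permutes S" using p r(1) by (intro permutes_compose permutes_inv)
    fix y assume "y \<in> S"
    then have "inv r y \<in> S" by (simp add: permutes_in_image[OF permutes_inv[OF r(1)]])
    then show "(p \<circ> inv r) y \<noteq> y" using r(2) permutes_inverses(1)[OF r(1)] by (metis comp_apply)
  qed
  moreover have "derangement S r" using r by (simp add: derangement_def)
  moreover have "p = p \<circ> inv r \<circ> r" by (simp add: comp_assoc permutes_inv_o(2)[OF r(1)])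
  ultimately show ?thesis by blast
qed

lemma latin_rectangle_pair:
  assumes "p permutes S" "q permutes S" "\<And>x. x \<in> S \<Longrightarrow> p x \<noteq> q x"
  shows "latin_rectangle S {p, q}"
  using assms by (auto simp: latin_rectangle_def pointwise_disjoint_def)

lemma exchange_derangements:
  fixes f :: "('a \<Rightarrow> 'a) \<Rightarrow> 'b::ab_group_add"
  assumes const: "latin_constant (U \<union> V) f"
    and fin: "finite (U \<union> V)" and ne: "U \<noteq> {}" "V \<noteq> {}" and disj: "U \<inter> V = {}"
    and \<sigma>: "\<sigma> permutes U \<union> V" and p: "derangement U p" and q: "derangement V q"
  shows "f (\<sigma> \<circ> q) - f (\<sigma> \<circ> q \<circ> p) = f \<sigma> - f (\<sigma> \<circ> p)"
proof -
  have perm: "p permutes U" "q permutes V" using p q by (simp_all add: derangement_def)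
  then have "p permutes U \<union> V" "q permutes U \<union> V" by (auto intro: permutes_subset)
  note perms = \<sigma> permutes_compose[OF this(1) \<sigma>] permutes_compose[OF this(2) \<sigma>]
    permutes_compose[OF this(1) permutes_compose[OF this(2) \<sigma>]]
  have inj: "\<sigma> x = \<sigma> y \<longleftrightarrow> x = y" for x y using permutes_inj[OF \<sigma>] by (simp add: inj_eq)
  have U: "p x \<noteq> x" "q x = x" "q (p x) = p x" if "x \<in> U" for x
  proof -
    have "p x \<in> U" using that by (simp add: permutes_in_image[OF perm(1)])
    then show "p x \<noteq> x" "q x = x" "q (p x) = p x"
      using that p disj permutes_not_in[OF perm(2)] by (auto simp: derangement_def)
  qed
  have V: "q x \<noteq> x" "p x = x" "p (q x) = q x" if "x \<in> V" for x
  proof -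
    have "q x \<in> V" using that by (simp add: permutes_in_image[OF perm(2)])
    then show "q x \<noteq> x" "p x = x" "p (q x) = q x"
      using that q disj permutes_not_in[OF perm(1)] by (auto simp: derangement_def)
  qed
  have neq: "x \<noteq> q (p x)" "p x \<noteq> q x" if "x \<in> U \<union> V" for x
    using that U V by (metis Un_iff)+
  have "sum f {\<sigma>, \<sigma> \<circ> q \<circ> p} = sum f {\<sigma> \<circ> p, \<sigma> \<circ> q}"
  proof (rule sum_latin_trade[OF const fin])
    show "latin_rectangle (U \<union> V) {\<sigma>, \<sigma> \<circ> q \<circ> p}" "latin_rectangle (U \<union> V) {\<sigma> \<circ> p, \<sigma> \<circ> q}"
      using neq by (auto intro!: latin_rectangle_pair perms simp: inj)
    fix x assume "x \<in> U \<union> V"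
    then show "(\<lambda>\<tau>. \<tau> x) ` {\<sigma>, \<sigma> \<circ> q \<circ> p} = (\<lambda>\<tau>. \<tau> x) ` {\<sigma> \<circ> p, \<sigma> \<circ> q}"
      using U V by auto
  qed (use ne in auto)
  moreover have "\<sigma> \<noteq> \<sigma> \<circ> q \<circ> p" "\<sigma> \<circ> p \<noteq> \<sigma> \<circ> q"
    using ne(1) neq by (metis UnI1 comp_apply ex_in_conv inj)+
  ultimately show ?thesis by (simp add: algebra_simps)
qed

lemma exchange_derangement_permutation:
  fixes f :: "('a \<Rightarrow> 'a) \<Rightarrow> 'b::ab_group_add"
  assumes const: "latin_constant (U \<union> V) f"
    and fin: "finite (U \<union> V)" and ne: "U \<noteq> {}" and disj: "U \<inter> V = {}" and card: "4 \<le> card V"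
    and \<sigma>: "\<sigma> permutes U \<union> V" and p: "derangement U p" and q: "q permutes V"
  shows "f (\<sigma> \<circ> q) - f (\<sigma> \<circ> q \<circ> p) = f \<sigma> - f (\<sigma> \<circ> p)"
proof -
  obtain r s where rs: "derangement V r" "derangement V s" "q = r \<circ> s"
    using ex_permutes_eq_comp_derangements[OF q card] by blast
  have "V \<noteq> {}" using card by auto
  note exchange = exchange_derangements[OF const fin ne this disj _ p]
  have "r permutes U \<union> V" using rs(1) by (auto simp: derangement_def intro: permutes_subset)
  then show ?thesis
    using exchange[OF \<sigma> rs(1)] exchange[OF permutes_compose[OF _ \<sigma>] rs(2), of r]
    by (simp add: rs(3) comp_assoc)
qed

section \<open>Matrices with few nonzero mixed differences\<close>

lemma ex_in_not_in_set:
  assumes "length xs < card A"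
  shows "\<exists>a\<in>A. a \<notin> set xs"
proof (rule ccontr)
  assume "\<not> ?thesis"
  then have "card A \<le> card (set xs)" by (intro card_mono) auto
  then show False using assms card_length[of xs] by linarith
qed

definition separations_meet :: "'a set \<Rightarrow> ('a \<Rightarrow> 'b) \<Rightarrow> ('a \<Rightarrow> 'c) \<Rightarrow> bool" where
  "separations_meet X g h \<longleftrightarrow> (\<forall>x\<in>X. \<forall>y\<in>X. \<forall>z\<in>X. \<forall>w\<in>X.
    g x \<noteq> g y \<longrightarrow> h z \<noteq> h w \<longrightarrow> {x, y} \<inter> {z, w} \<noteq> {})"

lemma separations_meet_commute: "separations_meet X g h \<Longrightarrow> separations_meet X h g"
  unfolding separations_meet_def by blast

lemma constant_off_separated_point:
  assumes card: "5 \<le> card X" and meet: "separations_meet X g h"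
    and c: "c \<in> X" and sep: "\<And>z. z \<in> X - {c, d} \<Longrightarrow> g c \<noteq> g z"
    and xy: "x \<in> X - {c}" "y \<in> X - {c}"
  shows "h x = h y"
proof (rule ccontr)
  assume "h x \<noteq> h y"
  obtain z where "z \<in> X" "z \<notin> set [c, d, x, y]"
    using ex_in_not_in_set[of "[c, d, x, y]" X] card by auto
  then have "z \<in> X - {c, d}" "{c, z} \<inter> {x, y} = {}" using xy by auto
  then show False
    using meet \<open>h x \<noteq> h y\<close> sep[of z] c xy unfolding separations_meet_def by blast
qed

lemma ex_constant_off_point:
  assumes card: "5 \<le> card X" and meet: "separations_meet X g h"
    and g: "x \<in> X" "y \<in> X" "g x \<noteq> g y" and h: "z \<in> X" "w \<in> X" "h z \<noteq> h w"
  shows "\<exists>c\<in>X. \<forall>u\<in>X - {c}. \<forall>v\<in>X - {c}. g u = g v"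
proof -
  obtain t where t: "t \<in> X - {x, y}"
    using ex_in_not_in_set[of "[x, y]" X] card by auto
  have off: "h u = h t" if "u \<in> X - {x, y}" for u
    using meet g t that unfolding separations_meet_def by blast
  have "h x \<noteq> h t \<or> h y \<noteq> h t"
  proof (rule ccontr)
    assume "\<not> ?thesis"
    then have "h u = h t" if "u \<in> X" for u using off that by (cases "u \<in> {x, y}") auto
    then show False using h by metis
  qed
  then obtain c d where c: "{x, y} = {c, d}" "h c \<noteq> h t" by (metis insert_commute)
  have "h c \<noteq> h u" if "u \<in> X - {c, d}" for u using off[of u] c that by simp
  moreover have "c \<in> X" using c(1) g(1,2) by (metis insert_iff singletonD)
  ultimately show ?thesis
    using constant_off_separated_point[OF card separations_meet_commute[OF meet], of c d] by blast
qed

lemma constant_off_transfer: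
  assumes card: "5 \<le> card X" and meet: "separations_meet X g h" and c: "c \<in> X"
    and g: "\<And>u v. u \<in> X - {c} \<Longrightarrow> v \<in> X - {c} \<Longrightarrow> g u = g v" "x \<in> X" "y \<in> X" "g x \<noteq> g y"
    and uv: "u \<in> X - {c}" "v \<in> X - {c}"
  shows "h u = h v"
proof -
  have "g c \<noteq> g z" if "z \<in> X - {c, c}" for z
  proof
    assume "g c = g z"
    then have "g t = g z" if "t \<in> X" for t
      using g(1)[of t z] that \<open>z \<in> X - {c, c}\<close> by (cases "t = c") auto
    then show False using g(2-4) by metis
  qed
  then show ?thesis using constant_off_separated_point[OF card meet c _ uv] by blast
qed

lemma ex_disjoint_unrelated_pairs:
  assumes R: "equivp R" and card: "4 \<le> card I"
    and no_centre: "\<And>r. r \<in> I \<Longrightarrow> \<exists>i\<in>I - {r}. \<exists>j\<in>I - {r}. \<not> R i j"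
  shows "\<exists>i j k l. {i, j, k, l} \<subseteq> I \<and> distinct [i, j, k, l] \<and> \<not> R i j \<and> \<not> R k l"
proof -
  obtain r where "r \<in> I" using ex_in_not_in_set[of "[]" I] card by auto
  then obtain i j where ij: "i \<in> I" "j \<in> I" "\<not> R i j" using no_centre by blast
  have refl: "R m m" for m using R by (rule equivp_reflp)
  then have "i \<noteq> j" using ij by blast
  show ?thesis
  proof (cases "\<exists>k\<in>I - {i, j}. \<exists>l\<in>I - {i, j}. \<not> R k l")
    case True
    then obtain k l where "k \<in> I - {i, j}" "l \<in> I - {i, j}" "\<not> R k l" by blast
    then show ?thesis using ij \<open>i \<noteq> j\<close> refl
      by (intro exI[of _ i] exI[of _ j] exI[of _ k] exI[of _ l]) auto
  next
    case False
    obtain k where k: "k \<in> I - {i, j}" using ex_in_not_in_set[of "[i, j]" I] card by auto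
    obtain l where l: "l \<in> I - {i, j, k}" using ex_in_not_in_set[of "[i, j, k]" I] card by auto
    have rest: "R k m" if "m \<in> I - {i, j}" for m using False k that by blast
    have "\<not> R k i"
    proof
      assume "R k i"
      then have "R k m" if "m \<in> I - {j}" for m using rest that by blast
      then show False using no_centre[OF ij(2)] equivp_symp[OF R] equivp_transp[OF R] by meson
    qed
    have "\<not> R k j"
    proof
      assume "R k j"
      then have "R k m" if "m \<in> I - {i}" for m using rest that by blast
      then show False using no_centre[OF ij(1)] equivp_symp[OF R] equivp_transp[OF R] by meson
    qed
    moreover have "R k l" using rest l by blast
    ultimately have "\<not> R l j" using equivp_transp[OF R] by blast
    then show ?thesis using \<open>\<not> R k i\<close> ij k l \<open>i \<noteq> j\<close>
      by (intro exI[of _ k] exI[of _ i] exI[of _ l] exI[of _ j]) auto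
  qed
qed

definition parallel_on :: "'a set \<Rightarrow> ('a \<Rightarrow> 'b::ab_group_add) \<Rightarrow> ('a \<Rightarrow> 'b) \<Rightarrow> bool" where
  "parallel_on X u v \<longleftrightarrow> (\<forall>x\<in>X. \<forall>y\<in>X. (u - v) x = (u - v) y)"

lemma parallel_on_iff:
  "parallel_on X u v \<longleftrightarrow> (\<forall>x\<in>X. \<forall>y\<in>X. u x - u y = v x - v y)"
  unfolding parallel_on_def by (simp add: algebra_simps)

lemma equivp_parallel_on: "equivp (\<lambda>i j. parallel_on X (a i) (a j))"
  by (intro equivpI reflpI sympI transpI) (simp_all add: parallel_on_iff)

lemma parallel_off_row_or_off_column:
  fixes a :: "'i \<Rightarrow> 'a \<Rightarrow> 'b::ab_group_add"
  assumes card: "5 \<le> card I" "5 \<le> card X"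
    and meet: "\<And>i j k l. {i, j, k, l} \<subseteq> I \<Longrightarrow> distinct [i, j, k, l] \<Longrightarrow>
      separations_meet X (a i - a j) (a k - a l)"
  shows "(\<exists>r\<in>I. \<forall>i\<in>I - {r}. \<forall>j\<in>I - {r}. parallel_on X (a i) (a j))
    \<or> (\<exists>c\<in>X. \<forall>i\<in>I. \<forall>j\<in>I. parallel_on (X - {c}) (a i) (a j))"
proof (cases "\<exists>r\<in>I. \<forall>i\<in>I - {r}. \<forall>j\<in>I - {r}. parallel_on X (a i) (a j)")
  case False
  obtain i j k l where I: "{i, j, k, l} \<subseteq> I" "distinct [i, j, k, l]"
    and nonpar: "\<not> parallel_on X (a i) (a j)" "\<not> parallel_on X (a k) (a l)"
    using ex_disjoint_unrelated_pairs[OF equivp_parallel_on[of X a], of I] card(1) False by auto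
  obtain c where c: "c \<in> X" "parallel_on (X - {c}) (a i) (a j)"
    using ex_constant_off_point[OF card(2) meet[OF I]] nonpar unfolding parallel_on_def by blast
  have transfer: "parallel_on (X - {c}) (a p') (a q')"
    if "parallel_on (X - {c}) (a p) (a q)" "\<not> parallel_on X (a p) (a q)"
      "{p, q, p', q'} \<subseteq> I" "distinct [p, q, p', q']" for p q p' q'
    using that(1,2) constant_off_transfer[OF card(2) meet[OF that(3,4)] c(1)]
    unfolding parallel_on_def by blast
  have kl: "parallel_on (X - {c}) (a k) (a l)" using transfer[OF c(2) nonpar(1) I] .
  obtain m where m: "m \<in> I" "m \<notin> {i, j, k, l}"
    using ex_in_not_in_set[of "[i, j, k, l]" I] card(1) by auto
  have "parallel_on (X - {c}) (a m) (a p)" if "p \<in> I" for p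
  proof (cases "p = m \<or> p \<in> {k, l}")
    case True
    then show ?thesis
      using transfer[OF c(2) nonpar(1), of m p] I m equivp_reflp[OF equivp_parallel_on] by auto
  next
    case False
    then show ?thesis using transfer[OF kl nonpar(2), of m p] I m that by auto
  qed
  then have "\<forall>i\<in>I. \<forall>j\<in>I. parallel_on (X - {c}) (a i) (a j)"
    using equivp_symp[OF equivp_parallel_on[of "X - {c}" a]]
      equivp_transp[OF equivp_parallel_on[of "X - {c}" a]] by blast
  then show ?thesis using c(1) by blast
qed simp

section \<open>Boolean functions additive on disjoint swaps\<close>

lemma ex_permutes_extending:
  assumes "length is = length xs" "distinct is" "distinct xs" "set is \<subseteq> S" "set xs \<subseteq> S"
  shows "\<exists>\<sigma>. \<sigma> permutes S \<and> map \<sigma> is = xs"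
  using assms
proof (induction "is" xs rule: list_induct2)
  case Nil
  then show ?case using permutes_id by (metis list.map(1))
next
  case (Cons i "is" x xs)
  then obtain \<sigma> where \<sigma>: "\<sigma> permutes S" "map \<sigma> is = xs" by auto
  have inS: "i \<in> S" "x \<in> S" using Cons.prems by auto
  let ?\<tau> = "transpose (\<sigma> i) x \<circ> \<sigma>"
  have "?\<tau> permutes S"
    using \<sigma>(1) inS by (intro permutes_compose permutes_swap_id) (auto simp: permutes_in_image)
  moreover have "?\<tau> j = \<sigma> j" if "j \<in> set is" for j
  proof -
    have "\<sigma> j \<noteq> \<sigma> i" using permutes_inj[OF \<sigma>(1)] that Cons.prems by (auto dest: injD)
    moreover have "\<sigma> j \<noteq> x" using \<sigma>(2) that Cons.prems by auto
    ultimately show ?thesis by simp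
  qed
  then have "map ?\<tau> is = xs" using \<sigma>(2) by (metis map_cong)
  then have "map ?\<tau> (i # is) = x # xs" by (simp only: list.map comp_apply transpose_apply_first)
  ultimately show ?case by (intro exI[of _ ?\<tau>] conjI)
qed

lemma permutes_inv_comp:
  assumes \<sigma>: "\<sigma> permutes S" and \<tau>: "\<tau> permutes S" and eq: "\<And>x. x \<in> A \<Longrightarrow> \<sigma> x = \<tau> x"
  shows "inv \<sigma> \<circ> \<tau> permutes S - A"
proof (rule permutes_superset)
  show "inv \<sigma> \<circ> \<tau> permutes S" using \<sigma> \<tau> by (intro permutes_compose permutes_inv)
  show "(inv \<sigma> \<circ> \<tau>) x = x" if "x \<in> S - (S - A)" for x
    using eq[of x] that permutes_inverses(2)[OF \<sigma>] by (metis Diff_Diff_Int Int_iff comp_apply)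
qed

lemma comp_inv_comp: "\<sigma> permutes S \<Longrightarrow> \<sigma> \<circ> (inv \<sigma> \<circ> \<tau>) = \<tau>"
  by (simp add: permutes_inv_o(1) flip: comp_assoc)

lemma eq_if_transposition_invariant:
  assumes fin: "finite S" and \<sigma>: "\<sigma> permutes S" and \<tau>: "\<tau> permutes S"
    and eq: "\<And>x. x \<in> A \<Longrightarrow> \<sigma> x = \<tau> x"
    and invariant: "\<And>\<rho> i j. \<rho> permutes S \<Longrightarrow> i \<in> S - A \<Longrightarrow> j \<in> S - A \<Longrightarrow>
      f (\<rho> \<circ> transpose i j) = f \<rho>"
  shows "f \<sigma> = f \<tau>"
proof -
  have "f (\<sigma> \<circ> p) = f \<sigma>" if "p permutes S - A" for p
    using finite_Diff[OF fin] that
  proof (induction rule: permutes_rev_induct)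
    case (swap i j p)
    have "\<sigma> \<circ> p permutes S"
      using \<sigma> swap.hyps by (intro permutes_compose) (auto intro: permutes_subset)
    then have "f (\<sigma> \<circ> p \<circ> transpose i j) = f (\<sigma> \<circ> p)" using swap.hyps by (intro invariant)
    then show ?case using swap.IH by (simp only: comp_assoc)
  qed simp
  from this[OF permutes_inv_comp[OF \<sigma> \<tau> eq]] show ?thesis by (simp add: comp_inv_comp[OF \<sigma>])
qed

locale swap_additive =
  fixes S :: "'a set" and f :: "('a \<Rightarrow> 'a) \<Rightarrow> 'b::linordered_idom"
  assumes card_ge: "5 \<le> card S"
    and exchange: "\<And>\<sigma> p i j. \<sigma> permutes S \<Longrightarrow> i \<in> S \<Longrightarrow> j \<in> S \<Longrightarrow> i \<noteq> j \<Longrightarrow>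
      p permutes S - {i, j} \<Longrightarrow>
      f (\<sigma> \<circ> p) - f (\<sigma> \<circ> p \<circ> transpose i j) = f \<sigma> - f (\<sigma> \<circ> transpose i j)"
begin

lemma finite_S: "finite S"
  using card_ge by (intro card_ge_0_finite) simp

lemma ex_notin: "length xs < 5 \<Longrightarrow> \<exists>s\<in>S. s \<notin> set xs"
  using ex_in_not_in_set card_ge by (meson less_le_trans)

lemma permutes_comp_transpose:
  "\<sigma> permutes S \<Longrightarrow> i \<in> S \<Longrightarrow> j \<in> S \<Longrightarrow> \<sigma> \<circ> transpose i j permutes S"
  by (intro permutes_compose permutes_swap_id)

text \<open>No permutation maps \<open>i \<noteq> j\<close> to a common value \<open>x\<close>; setting \<open>swap_diff i j x x = 0\<close> makes
  the difference additive in the values without exception.\<close>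
definition swap_diff :: "'a \<Rightarrow> 'a \<Rightarrow> 'a \<Rightarrow> 'a \<Rightarrow> 'b" where
  "swap_diff i j x y = (if i = j \<or> x = y then 0 else
    let \<sigma> = (SOME \<sigma>. \<sigma> permutes S \<and> \<sigma> i = x \<and> \<sigma> j = y) in f \<sigma> - f (\<sigma> \<circ> transpose i j))"

lemma swap_diff_eq:
  assumes \<sigma>: "\<sigma> permutes S" and ij: "i \<in> S" "j \<in> S"
  shows "f \<sigma> - f (\<sigma> \<circ> transpose i j) = swap_diff i j (\<sigma> i) (\<sigma> j)"
proof (cases "i = j")
  case False
  then have neq: "\<sigma> i \<noteq> \<sigma> j" using permutes_inj[OF \<sigma>] by (simp add: inj_eq)
  define \<tau> where "\<tau> = (SOME \<tau>. \<tau> permutes S \<and> \<tau> i = \<sigma> i \<and> \<tau> j = \<sigma> j)"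
  have \<tau>: "\<tau> permutes S \<and> \<tau> i = \<sigma> i \<and> \<tau> j = \<sigma> j"
    unfolding \<tau>_def by (rule someI[of _ \<sigma>]) (use \<sigma> in simp)
  then have "inv \<tau> \<circ> \<sigma> permutes S - {i, j}" using \<sigma> by (intro permutes_inv_comp) auto
  from exchange[OF conjunct1[OF \<tau>] ij False this]
  have "f \<sigma> - f (\<sigma> \<circ> transpose i j) = f \<tau> - f (\<tau> \<circ> transpose i j)"
    by (simp only: comp_inv_comp[OF conjunct1[OF \<tau>]])
  then show ?thesis using False neq by (simp add: swap_diff_def Let_def \<tau>_def)
qed (simp add: swap_diff_def)

lemma swap_diff_degenerate [simp]: "swap_diff i i x y = 0" "swap_diff i j x x = 0"
  by (simp_all add: swap_diff_def)

lemma swap_diff_antisym: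
  assumes "i \<in> S" "j \<in> S" "x \<in> S" "y \<in> S"
  shows "swap_diff i j y x = - swap_diff i j x y"
proof (cases "i = j \<or> x = y")
  case False
  then obtain \<sigma> where \<sigma>: "\<sigma> permutes S" "\<sigma> i = x" "\<sigma> j = y"
    using ex_permutes_extending[of "[i, j]" "[x, y]" S] assms by auto
  show ?thesis
    using swap_diff_eq[OF \<sigma>(1) assms(1,2)]
      swap_diff_eq[OF permutes_comp_transpose[OF \<sigma>(1) assms(1,2)] assms(1,2)] \<sigma>(2,3)
    by (simp add: comp_assoc)
qed auto

lemma swap_diff_triangle:
  assumes S: "{i, j, k} \<subseteq> S" "{x, y, z} \<subseteq> S" and distinct: "distinct [i, j, k]" "distinct [x, y, z]"
  shows "swap_diff i k x z = swap_diff i j x y + swap_diff j k x z + swap_diff i j y z"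
proof -
  obtain \<sigma> where \<sigma>: "\<sigma> permutes S" "\<sigma> i = x" "\<sigma> j = y" "\<sigma> k = z"
    using ex_permutes_extending[of "[i, j, k]" "[x, y, z]" S] assms by auto
  define \<sigma>' \<sigma>'' where "\<sigma>' = \<sigma> \<circ> transpose i j" and "\<sigma>'' = \<sigma>' \<circ> transpose j k"
  have perm: "\<sigma>' permutes S" "\<sigma>'' permutes S"
    using \<sigma>(1) S(1) unfolding \<sigma>'_def \<sigma>''_def by (auto intro!: permutes_comp_transpose)
  have "\<sigma>'' \<circ> transpose i j = \<sigma> \<circ> transpose i k"
    using transpose_comp_triple[of i k j] distinct(1) by (simp add: \<sigma>''_def \<sigma>'_def comp_assoc)
  moreover have "f \<sigma> - f (\<sigma> \<circ> transpose i k) = swap_diff i k x z"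
    using swap_diff_eq[OF \<sigma>(1), of i k] \<sigma> S(1) by simp
  moreover have "f \<sigma> - f \<sigma>' = swap_diff i j x y"
    using swap_diff_eq[OF \<sigma>(1), of i j] \<sigma> S(1) by (simp add: \<sigma>'_def)
  moreover have "f \<sigma>' - f \<sigma>'' = swap_diff j k x z"
    using swap_diff_eq[OF perm(1), of j k] \<sigma> S(1) distinct(1) by (auto simp: \<sigma>''_def \<sigma>'_def)
  moreover have "f \<sigma>'' - f (\<sigma>'' \<circ> transpose i j) = swap_diff i j y z"
    using swap_diff_eq[OF perm(2), of i j] \<sigma> S(1) distinct(1) by (auto simp: \<sigma>''_def \<sigma>'_def)
  ultimately show ?thesis by (simp add: algebra_simps)
qed

text \<open>By the triangle identity \<open>swap_diff i j x y + swap_diff i j y z\<close> does not depend on \<open>y\<close>.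
  Three such replacements exchange two terms of a cyclic sum, which negates it.\<close>
lemma swap_diff_add_values:
  assumes ij: "i \<in> S" "j \<in> S" and xyz: "x \<in> S" "y \<in> S" "z \<in> S"
  shows "swap_diff i j x y + swap_diff i j y z = swap_diff i j x z"
proof (cases "i = j \<or> x = y \<or> y = z \<or> x = z")
  case True
  then show ?thesis using swap_diff_antisym[OF ij xyz(1,2)] by auto
next
  case False
  define h where "h = swap_diff i j"
  obtain k where k: "k \<in> S" "k \<notin> set [i, j]" using ex_notin[of "[i, j]"] by auto
  obtain w where w: "w \<in> S" "w \<notin> set [x, y, z]" using ex_notin[of "[x, y, z]"] by auto
  have antisym: "h q p = - h p q" if "p \<in> S" "q \<in> S" for p q
    unfolding h_def using swap_diff_antisym[OF ij that] .
  have replace: "h p q + h q r = h p q' + h q' r"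
    if "{p, q, q', r} \<subseteq> S" "distinct [p, q, r]" "distinct [p, q', r]" for p q q' r
    unfolding h_def
    using swap_diff_triangle[of i j k p q r] swap_diff_triangle[of i j k p q' r] that ij k False
    by auto
  have "h x y + h y z = h x w + h w z" using replace[of x y w z] xyz w False by auto
  moreover have "h z x + h x w = h z y + h y w" using replace[of z x y w] xyz w False by auto
  moreover have "h y w + h w z = h y x + h x z" using replace[of y w x z] xyz w False by auto
  ultimately show ?thesis
    using antisym[of x y] antisym[of y z] antisym[of x z] xyz unfolding h_def by simp
qed

lemma swap_diff_swap_positions:
  assumes ij: "i \<in> S" "j \<in> S" and xy: "x \<in> S" "y \<in> S"
  shows "swap_diff j i x y = - swap_diff i j x y"
proof (cases "i = j \<or> x = y")
  case False
  then obtain \<sigma> where \<sigma>: "\<sigma> permutes S" "\<sigma> j = x" "\<sigma> i = y"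
    using ex_permutes_extending[of "[j, i]" "[x, y]" S] assms by auto
  then have "swap_diff j i x y = swap_diff i j y x"
    using swap_diff_eq[OF \<sigma>(1) ij] swap_diff_eq[OF \<sigma>(1) ij(2,1)] by (simp add: transpose_commute)
  then show ?thesis using swap_diff_antisym[OF ij xy] by simp
qed auto

lemma swap_diff_add_positions:
  assumes ijk: "i \<in> S" "j \<in> S" "k \<in> S" and xz: "x \<in> S" "z \<in> S"
  shows "swap_diff i j x z + swap_diff j k x z = swap_diff i k x z"
proof (cases "i = j \<or> j = k \<or> i = k \<or> x = z")
  case True
  then show ?thesis using swap_diff_swap_positions[OF ijk(1,2) xz] by auto
next
  case False
  obtain y where y: "y \<in> S" "y \<notin> set [x, z]" using ex_notin[of "[x, z]"] by auto
  then show ?thesis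
    using swap_diff_triangle[of i j k x y z] swap_diff_add_values[OF ijk(1,2) xz(1) y(1) xz(2)]
      False ijk xz by auto
qed

text \<open>Equivalently, \<open>f \<sigma> - (\<Sum>i\<in>S. a i (\<sigma> i))\<close> is the same for all permutations \<open>\<sigma>\<close> of \<open>S\<close>.\<close>
definition swap_potential :: "('a \<Rightarrow> 'a \<Rightarrow> 'b) \<Rightarrow> bool" where
  "swap_potential a \<longleftrightarrow> (\<forall>\<sigma> i j. \<sigma> permutes S \<longrightarrow> i \<in> S \<longrightarrow> j \<in> S \<longrightarrow>
    f \<sigma> - f (\<sigma> \<circ> transpose i j) = (a i - a j) (\<sigma> i) - (a i - a j) (\<sigma> j))"

lemma swap_potentialD:
  assumes "swap_potential a" "\<sigma> permutes S" "i \<in> S" "j \<in> S"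
  shows "f \<sigma> - f (\<sigma> \<circ> transpose i j) = (a i - a j) (\<sigma> i) - (a i - a j) (\<sigma> j)"
  using assms unfolding swap_potential_def by blast

lemma ex_swap_potential: "\<exists>a. swap_potential a"
proof -
  obtain p where p: "p \<in> S" using ex_notin[of "[]"] by auto
  define a where "a i x = swap_diff i p x p" for i x
  have "f \<sigma> - f (\<sigma> \<circ> transpose i j) = (a i - a j) (\<sigma> i) - (a i - a j) (\<sigma> j)"
    if \<sigma>: "\<sigma> permutes S" and ij: "i \<in> S" "j \<in> S" for \<sigma> i j
  proof -
    have xy: "\<sigma> i \<in> S" "\<sigma> j \<in> S" using ij by (simp_all add: permutes_in_image[OF \<sigma>])
    have a: "swap_diff k p (\<sigma> i) (\<sigma> j) = a k (\<sigma> i) - a k (\<sigma> j)" if "k \<in> S" for k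
      using swap_diff_add_values[OF that p xy p] by (simp add: a_def algebra_simps)
    show ?thesis
      using swap_diff_eq[OF \<sigma> ij] swap_diff_add_positions[OF ij p xy] a[OF ij(1)] a[OF ij(2)]
      by (simp add: algebra_simps)
  qed
  then show ?thesis unfolding swap_potential_def by blast
qed

lemma separations_meet_swap_potential:
  assumes bool: "\<And>\<sigma>. \<sigma> permutes S \<Longrightarrow> f \<sigma> \<in> {0, 1}" and a: "swap_potential a"
    and S: "{i, j, k, l} \<subseteq> S" and distinct: "distinct [i, j, k, l]"
  shows "separations_meet S (a i - a j) (a k - a l)"
  unfolding separations_meet_def
proof (intro ballI impI notI)
  fix x y z w
  assume X: "x \<in> S" "y \<in> S" "z \<in> S" "w \<in> S" and "{x, y} \<inter> {z, w} = {}"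
    and sep: "(a i - a j) x \<noteq> (a i - a j) y" "(a k - a l) z \<noteq> (a k - a l) w"
  then have "distinct [x, y, z, w]" by auto
  then obtain \<sigma> where \<sigma>: "\<sigma> permutes S" "\<sigma> i = x" "\<sigma> j = y" "\<sigma> k = z" "\<sigma> l = w"
    using ex_permutes_extending[of "[i, j, k, l]" "[x, y, z, w]" S] S X distinct by auto
  define p q where "p = transpose i j" and "q = transpose k l"
  have sensitive: "f \<sigma> \<noteq> f (\<sigma> \<circ> p)" "f \<sigma> \<noteq> f (\<sigma> \<circ> q)"
    using swap_potentialD[OF a \<sigma>(1), of i j] swap_potentialD[OF a \<sigma>(1), of k l] sep S \<sigma>(2-5)
    by (auto simp: p_def q_def)
  have "q permutes S - {i, j}"
    unfolding q_def using S distinct by (intro permutes_swap_id) auto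
  then have "f (\<sigma> \<circ> q) - f (\<sigma> \<circ> q \<circ> p) = f \<sigma> - f (\<sigma> \<circ> p)"
    unfolding p_def using S distinct by (intro exchange[OF \<sigma>(1)]) auto
  moreover have "\<sigma> \<circ> p permutes S" "\<sigma> \<circ> q permutes S" "\<sigma> \<circ> q \<circ> p permutes S"
    using \<sigma>(1) S unfolding p_def q_def by (auto intro!: permutes_comp_transpose)
  ultimately show False
    using sensitive bool[OF \<sigma>(1)] bool[of "\<sigma> \<circ> p"] bool[of "\<sigma> \<circ> q"] bool[of "\<sigma> \<circ> q \<circ> p"] by auto
qed

lemma eq_if_parallel_off_row:
  assumes a: "swap_potential a"
    and row: "\<And>i j. i \<in> S - {r} \<Longrightarrow> j \<in> S - {r} \<Longrightarrow> parallel_on S (a i) (a j)"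
    and \<sigma>: "\<sigma> permutes S" and \<tau>: "\<tau> permutes S" and eq: "\<sigma> r = \<tau> r"
  shows "f \<sigma> = f \<tau>"
proof (rule eq_if_transposition_invariant[OF finite_S \<sigma> \<tau>, of "{r}"])
  fix \<rho> i j assume \<rho>: "\<rho> permutes S" and ij: "i \<in> S - {r}" "j \<in> S - {r}"
  have "\<rho> i \<in> S" "\<rho> j \<in> S" using ij by (simp_all add: permutes_in_image[OF \<rho>])
  then have "(a i - a j) (\<rho> i) = (a i - a j) (\<rho> j)"
    using row[OF ij] unfolding parallel_on_def by blast
  then show "f (\<rho> \<circ> transpose i j) = f \<rho>"
    using swap_potentialD[OF a \<rho>, of i j] ij by simp
qed (use eq in simp)

lemma eq_if_parallel_off_column:
  assumes a: "swap_potential a"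
    and column: "\<And>i j. i \<in> S \<Longrightarrow> j \<in> S \<Longrightarrow> parallel_on (S - {c}) (a i) (a j)"
    and \<sigma>: "\<sigma> permutes S" and \<tau>: "\<tau> permutes S" and eq: "inv \<sigma> c = inv \<tau> c"
  shows "f \<sigma> = f \<tau>"
proof -
  have "f (inv (inv \<sigma>)) = f (inv (inv \<tau>))"
  proof (rule eq_if_transposition_invariant[OF finite_S permutes_inv[OF \<sigma>] permutes_inv[OF \<tau>],
        of "{c}"])
    fix \<rho> x y assume \<rho>: "\<rho> permutes S" and xy: "x \<in> S - {c}" "y \<in> S - {c}"
    note inv_\<rho> = permutes_inv[OF \<rho>]
    have "inv (\<rho> \<circ> transpose x y) = transpose x y \<circ> inv \<rho>"
      using permutes_bij[OF \<rho>] by (simp add: o_inv_distrib)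
    also have "\<dots> = inv \<rho> \<circ> transpose (\<rho> x) (\<rho> y)"
      using transpose_comp_eq[OF permutes_bij[OF inv_\<rho>]] by (simp only: permutes_inv_inv[OF \<rho>])
    finally have swap: "inv (\<rho> \<circ> transpose x y) = inv \<rho> \<circ> transpose (\<rho> x) (\<rho> y)" .
    have ij: "\<rho> x \<in> S" "\<rho> y \<in> S" using xy by (simp_all add: permutes_in_image[OF \<rho>])
    then have "(a (\<rho> x) - a (\<rho> y)) x = (a (\<rho> x) - a (\<rho> y)) y"
      using column[OF ij] xy unfolding parallel_on_def by blast
    then show "f (inv (\<rho> \<circ> transpose x y)) = f (inv \<rho>)"
      using swap_potentialD[OF a inv_\<rho> ij] by (simp add: swap permutes_inverses(2)[OF \<rho>])
  qed (use eq in simp)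
  then show ?thesis by (simp add: permutes_inv_inv[OF \<sigma>] permutes_inv_inv[OF \<tau>])
qed

theorem boolean_dictator:
  assumes bool: "\<And>\<sigma>. \<sigma> permutes S \<Longrightarrow> f \<sigma> \<in> {0, 1}"
  shows "(\<exists>r\<in>S. \<forall>\<sigma> \<tau>. \<sigma> permutes S \<longrightarrow> \<tau> permutes S \<longrightarrow> \<sigma> r = \<tau> r \<longrightarrow> f \<sigma> = f \<tau>)
    \<or> (\<exists>c\<in>S. \<forall>\<sigma> \<tau>. \<sigma> permutes S \<longrightarrow> \<tau> permutes S \<longrightarrow> inv \<sigma> c = inv \<tau> c \<longrightarrow> f \<sigma> = f \<tau>)"
proof -
  obtain a where a: "swap_potential a" using ex_swap_potential by blast
  have "(\<exists>r\<in>S. \<forall>i\<in>S - {r}. \<forall>j\<in>S - {r}. parallel_on S (a i) (a j))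
    \<or> (\<exists>c\<in>S. \<forall>i\<in>S. \<forall>j\<in>S. parallel_on (S - {c}) (a i) (a j))"
    by (rule parallel_off_row_or_off_column[OF card_ge card_ge
          separations_meet_swap_potential[OF bool a]])
  then consider (row) r where "r \<in> S" "\<forall>i\<in>S - {r}. \<forall>j\<in>S - {r}. parallel_on S (a i) (a j)"
    | (column) c where "c \<in> S" "\<forall>i\<in>S. \<forall>j\<in>S. parallel_on (S - {c}) (a i) (a j)"
    by blast
  then show ?thesis
  proof cases
    case row
    have "f \<sigma> = f \<tau>" if "\<sigma> permutes S" "\<tau> permutes S" "\<sigma> r = \<tau> r" for \<sigma> \<tau>
      using eq_if_parallel_off_row[OF a _ that] row(2) by simp
    then show ?thesis using row(1) by blast
  next
    case column
    have "f \<sigma> = f \<tau>" if "\<sigma> permutes S" "\<tau> permutes S" "inv \<sigma> c = inv \<tau> c" for \<sigma> \<tau>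
      using eq_if_parallel_off_column[OF a _ that] column(2) by simp
    then show ?thesis using column(1) by blast
  qed
qed

end

lemma swap_additive_if_latin_constant:
  fixes f :: "('a \<Rightarrow> 'a) \<Rightarrow> 'b::linordered_idom"
  assumes card: "6 \<le> card S" and const: "latin_constant S f"
  shows "swap_additive S f"
proof
  fix \<sigma> p i j
  assume \<sigma>: "\<sigma> permutes S" and ij: "i \<in> S" "j \<in> S" "i \<noteq> j" and p: "p permutes S - {i, j}"
  let ?U = "{i, j}" and ?V = "S - {i, j}"
  have fin: "finite S" using card by (intro card_ge_0_finite) simp
  have S: "?U \<union> ?V = S" using ij by blast
  have "4 \<le> card ?V" using card ij fin by (simp add: card_Diff_subset)
  moreover have "derangement ?U (transpose i j)"
    using ij(3) by (auto simp: derangement_def intro: permutes_swap_id)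
  ultimately show "f (\<sigma> \<circ> p) - f (\<sigma> \<circ> p \<circ> transpose i j) = f \<sigma> - f (\<sigma> \<circ> transpose i j)"
    using exchange_derangement_permutation[of ?U ?V f \<sigma> "transpose i j" p] const fin \<sigma> p
    unfolding S by simp
qed (use card in simp)

section \<open>Averaging over the translates of a Latin square\<close>

lemma latin_square_translate:
  assumes g: "g permutes S" and L: "latin_square S L"
  shows "latin_square S ((\<circ>) g ` L)"
proof -
  have inj_g: "inj g" using g by (rule permutes_inj)
  have rectangle: "latin_rectangle S L" using L by (simp add: latin_square_def)
  have "inj_on ((\<circ>) g) L" using fun.inj_map[OF inj_g] by (rule inj_on_subset) simp
  moreover have "inj_on (\<lambda>p. p x) ((\<circ>) g ` L)" if "x \<in> S" for x
    using latin_rectangleD(3)[OF rectangle that] injD[OF inj_g] by (auto simp: inj_on_def)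
  ultimately show ?thesis
    using L g by (auto simp: latin_square_def latin_rectangle_def pointwise_disjoint_def
        card_image intro: permutes_compose)
qed

lemma sum_latin_translates:
  fixes f :: "('a \<Rightarrow> 'a) \<Rightarrow> 'b::semiring_1"
  assumes L: "latin_square S L"
  shows "(\<Sum>g | g permutes S. sum f ((\<circ>) g ` L)) = of_nat (card S) * (\<Sum>g | g permutes S. f g)"
proof -
  have perm: "p permutes S" if "p \<in> L" for p
    using L that by (simp add: latin_square_def latin_rectangle_def)
  have "inj_on ((\<circ>) g) L" if "g permutes S" for g
    using fun.inj_map[OF permutes_inj[OF that]] by (rule inj_on_subset) simp
  then have "(\<Sum>g | g permutes S. sum f ((\<circ>) g ` L)) = (\<Sum>g | g permutes S. \<Sum>p\<in>L. f (g \<circ> p))"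
    by (simp add: sum.reindex)
  also have "\<dots> = (\<Sum>p\<in>L. \<Sum>g | g permutes S. f (g \<circ> p))" by (rule sum.swap)
  also have "\<dots> = (\<Sum>p\<in>L. \<Sum>g | g permutes S. f g)"
    by (intro sum.cong refl sum_permutations_compose_right[symmetric] perm)
  also have "\<dots> = of_nat (card S) * (\<Sum>g | g permutes S. f g)"
    using L by (simp add: latin_square_def)
  finally show ?thesis .
qed

section \<open>Families of permutations with bounded matching number\<close>

lemma finite_Sym: "finite (Sym n)"
  by (simp add: Sym_def finite_permutations)

lemma card_Sym: "card (Sym n) = fact n"
  by (simp add: Sym_def card_permutations)

lemma inv_in_Sym: "\<sigma> \<in> Sym n \<Longrightarrow> inv \<sigma> \<in> Sym n"
  by (simp add: Sym_def permutes_inv)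

lemma inv_inv_Sym: "\<sigma> \<in> Sym n \<Longrightarrow> inv (inv \<sigma>) = \<sigma>"
  by (auto simp: Sym_def dest: permutes_inv_inv)

lemma card_le_nu:
  assumes "F \<subseteq> Sym n" "G \<subseteq> F" "pointwise_disjoint {1..n} G"
  shows "card G \<le> nu n F"
  unfolding nu_def
proof (rule Max_ge)
  have "finite (card ` Pow F)" using finite_subset[OF assms(1) finite_Sym] by simp
  then show "finite {card G | G. G \<subseteq> F \<and> (\<forall>\<sigma>\<in>G. \<forall>\<tau>\<in>G. \<sigma> \<noteq> \<tau> \<longrightarrow> \<not> intersect n \<sigma> \<tau>)}"
    by (rule rev_finite_subset) auto
  have "\<not> intersect n \<sigma> \<tau>" if "\<sigma> \<in> G" "\<tau> \<in> G" "\<sigma> \<noteq> \<tau>" for \<sigma> \<tau>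
    using assms(3) that unfolding pointwise_disjoint_def intersect_def by (meson inj_onD)
  then show "card G \<in> {card G | G. G \<subseteq> F \<and> (\<forall>\<sigma>\<in>G. \<forall>\<tau>\<in>G. \<sigma> \<noteq> \<tau> \<longrightarrow> \<not> intersect n \<sigma> \<tau>)}"
    using assms(2) by blast
qed

lemma card_latin_square_Int_le_nu:
  assumes F: "F \<subseteq> Sym n" and L: "latin_square {1..n} L"
  shows "card (L \<inter> F) \<le> nu n F"
proof (rule card_le_nu[OF F])
  show "pointwise_disjoint {1..n} (L \<inter> F)"
    using L by (auto simp: latin_square_def latin_rectangle_def intro: pointwise_disjoint_subset)
qed simp

lemma sum_card_latin_translates:
  assumes F: "F \<subseteq> Sym n" and L: "latin_square {1..n} L"
  shows "(\<Sum>g\<in>Sym n. card ((\<circ>) g ` L \<inter> F)) = n * card F"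
proof -
  have "(\<Sum>g\<in>Sym n. card ((\<circ>) g ` L \<inter> F))
      = (\<Sum>g\<in>Sym n. \<Sum>\<sigma>\<in>(\<circ>) g ` L. of_bool (\<sigma> \<in> F))"
    using finite_latin_square[OF L] by simp
  also have "\<dots> = n * (\<Sum>\<sigma>\<in>Sym n. of_bool (\<sigma> \<in> F))"
    using sum_latin_translates[OF L, of "\<lambda>\<sigma>. of_bool (\<sigma> \<in> F) :: nat"] unfolding Sym_def by simp
  also have "(\<Sum>\<sigma>\<in>Sym n. of_bool (\<sigma> \<in> F)) = card F"
    using F finite_Sym by (simp add: Int_absorb1)
  finally show ?thesis .
qed

lemma card_le_nu_times_fact:
  assumes n: "1 \<le> n" and F: "F \<subseteq> Sym n"
  shows "card F \<le> nu n F * fact (n - 1)"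
proof -
  obtain L where L: "latin_square {1..n} L" using ex_latin_square[of "{1..n}"] n by auto
  have "n * card F = (\<Sum>g\<in>Sym n. card ((\<circ>) g ` L \<inter> F))"
    using sum_card_latin_translates[OF F L] by simp
  also have "\<dots> \<le> (\<Sum>g\<in>Sym n. nu n F)"
    by (intro sum_mono card_latin_square_Int_le_nu[OF F] latin_square_translate[OF _ L])
      (simp add: Sym_def)
  also have "\<dots> = n * (nu n F * fact (n - 1))"
    using n fact_reduce[of n, where 'a = nat] by (simp add: card_Sym)
  finally show ?thesis using n by simp
qed

lemma card_latin_square_Int_eq_nu:
  assumes n: "1 \<le> n" and F: "F \<subseteq> Sym n" and card: "card F = nu n F * fact (n - 1)"
    and L: "latin_square {1..n} L"
  shows "card (L \<inter> F) = nu n F"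
proof -
  have "(\<Sum>g\<in>Sym n. card ((\<circ>) g ` L \<inter> F)) = (\<Sum>g\<in>Sym n. nu n F)"
    using n fact_reduce[of n, where 'a = nat]
    by (simp add: sum_card_latin_translates[OF F L] card card_Sym)
  moreover have "card ((\<circ>) g ` L \<inter> F) \<le> nu n F" if "g \<in> Sym n" for g
    using that by (intro card_latin_square_Int_le_nu[OF F] latin_square_translate[OF _ L])
      (simp add: Sym_def)
  moreover have "id \<in> Sym n" by (simp add: Sym_def)
  ultimately have "card ((\<circ>) id ` L \<inter> F) = nu n F"
    using sum_mono_inv[of "\<lambda>g. card ((\<circ>) g ` L \<inter> F)" "Sym n" "\<lambda>_. nu n F" id] finite_Sym by blast
  then show ?thesis by simp
qed

lemma latin_constant_of_extremal:
  assumes "1 \<le> n" "F \<subseteq> Sym n" "card F = nu n F * fact (n - 1)"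
  shows "latin_constant {1..n} (\<lambda>\<sigma>. of_bool (\<sigma> \<in> F) :: int)"
proof -
  have "(\<Sum>\<sigma>\<in>L. of_bool (\<sigma> \<in> F)) = int (nu n F)" if L: "latin_square {1..n} L" for L
    using card_latin_square_Int_eq_nu[OF assms L] finite_latin_square[OF L] by simp
  then show ?thesis by (simp add: latin_constant_def)
qed

lemma card_Star:
  assumes x: "x \<in> {1..n}" and y: "y \<in> {1..n}"
  shows "card (Star n x y) = fact (n - 1)"
proof -
  let ?T = "{1..n} - {x}"
  have insert: "insert x ?T = {1..n}" using x by blast
  have "Star n x y = (\<circ>) (transpose x y) ` {p. p permutes ?T}"
  proof (intro equalityI subsetI)
    fix \<sigma> assume "\<sigma> \<in> Star n x y"
    then have \<sigma>: "\<sigma> permutes insert x ?T" "\<sigma> x = y"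
      unfolding insert by (simp_all add: Star_def Sym_def)
    have "transpose x y \<circ> \<sigma> permutes ?T" using permutes_insert_lemma[OF \<sigma>(1)] unfolding \<sigma>(2) .
    moreover have "\<sigma> = transpose x y \<circ> (transpose x y \<circ> \<sigma>)" by (simp add: fun_eq_iff)
    ultimately show "\<sigma> \<in> (\<circ>) (transpose x y) ` {p. p permutes ?T}" by blast
  next
    fix \<sigma> assume "\<sigma> \<in> (\<circ>) (transpose x y) ` {p. p permutes ?T}"
    then obtain p where p: "p permutes ?T" "\<sigma> = transpose x y \<circ> p" by blast
    have "p permutes {1..n}" using p(1) by (rule permutes_subset) blast
    moreover have "p x = x" using permutes_not_in[OF p(1)] by simp
    ultimately show "\<sigma> \<in> Star n x y"
      using permutes_compose[OF _ permutes_swap_id[OF x y]] p(2) by (simp add: Star_def Sym_def)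
  qed
  moreover have "inj_on ((\<circ>) (transpose x y)) {p. p permutes ?T}"
    using fun.inj_map[OF inj_transpose] by (rule inj_on_subset) simp
  ultimately show ?thesis using x by (simp add: card_image card_permutations)
qed

lemma inv_image_Star: "inv ` Star n x y = Star n y x"
proof -
  have inv_in_Star: "inv \<sigma> \<in> Star n v u" if "\<sigma> \<in> Star n u v" for \<sigma> u v
  proof -
    have \<sigma>: "\<sigma> permutes {1..n}" "\<sigma> u = v" using that by (simp_all add: Star_def Sym_def)
    then show ?thesis
      using permutes_inv[OF \<sigma>(1)] by (simp add: Star_def Sym_def permutes_inv_eq[OF \<sigma>(1)])
  qed
  show ?thesis
  proof (intro equalityI subsetI)
    fix \<sigma> assume "\<sigma> \<in> inv ` Star n x y"
    then show "\<sigma> \<in> Star n y x" using inv_in_Star by blast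
  next
    fix \<sigma> assume \<sigma>: "\<sigma> \<in> Star n y x"
    then have "inv (inv \<sigma>) = \<sigma>" using inv_inv_Sym[of \<sigma> n] by (simp add: Star_def)
    then show "\<sigma> \<in> inv ` Star n x y" by (rule image_eqI[OF sym inv_in_Star[OF \<sigma>]])
  qed
qed

lemma Union_Star_if_determined_by_value:
  assumes F: "F \<subseteq> Sym n" and r: "r \<in> {1..n}"
    and determined: "\<And>\<sigma> \<tau>. \<sigma> \<in> F \<Longrightarrow> \<tau> \<in> Sym n \<Longrightarrow> \<sigma> r = \<tau> r \<Longrightarrow> \<tau> \<in> F"
  obtains Y where "Y \<subseteq> {1..n}" "F = (\<Union>y\<in>Y. Star n r y)" "card F = card Y * fact (n - 1)"
proof -
  define Y where "Y = (\<lambda>\<sigma>. \<sigma> r) ` F"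
  have "\<sigma> r \<in> {1..n}" if "\<sigma> \<in> F" for \<sigma>
    using that F r permutes_in_image[of \<sigma> "{1..n}"] unfolding Sym_def by blast
  then have Y: "Y \<subseteq> {1..n}" unfolding Y_def by blast
  have F_eq: "F = (\<Union>y\<in>Y. Star n r y)"
  proof (intro equalityI subsetI)
    fix \<tau> assume "\<tau> \<in> (\<Union>y\<in>Y. Star n r y)"
    then obtain \<sigma> where "\<sigma> \<in> F" "\<tau> \<in> Sym n" "\<sigma> r = \<tau> r" by (auto simp: Y_def Star_def)
    then show "\<tau> \<in> F" by (rule determined)
  qed (use F in \<open>auto simp: Y_def Star_def\<close>)
  have "finite (Star n r y)" for y using finite_Sym by (simp add: Star_def)
  then have "card (\<Union>y\<in>Y. Star n r y) = (\<Sum>y\<in>Y. card (Star n r y))"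
    using finite_subset[OF Y] by (intro card_UN_disjoint) (auto simp: Star_def)
  also have "\<dots> = (\<Sum>y\<in>Y. fact (n - 1))" using card_Star[OF r] Y by (intro sum.cong) auto
  finally show thesis using that[OF Y F_eq] by (simp flip: F_eq)
qed

lemma Union_Star_if_determined_by_position:
  assumes F: "F \<subseteq> Sym n" and c: "c \<in> {1..n}"
    and determined: "\<And>\<sigma> \<tau>. \<sigma> \<in> F \<Longrightarrow> \<tau> \<in> Sym n \<Longrightarrow> inv \<sigma> c = inv \<tau> c \<Longrightarrow> \<tau> \<in> F"
  obtains X where "X \<subseteq> {1..n}" "F = (\<Union>x\<in>X. Star n x c)" "card F = card X * fact (n - 1)"
proof -
  have inv_inv: "inv (inv \<sigma>) = \<sigma>" if "\<sigma> \<in> F" for \<sigma> using F that inv_inv_Sym by blast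
  have inv_F: "inv ` F \<subseteq> Sym n" using F inv_in_Sym by blast
  have "\<tau> \<in> inv ` F" if "\<sigma> \<in> inv ` F" and \<tau>: "\<tau> \<in> Sym n" and eq: "\<sigma> c = \<tau> c" for \<sigma> \<tau>
  proof -
    obtain \<rho> where \<rho>: "\<rho> \<in> F" "\<sigma> = inv \<rho>" using \<open>\<sigma> \<in> inv ` F\<close> by blast
    have "inv \<tau> \<in> F"
      using eq by (intro determined[OF \<rho>(1) inv_in_Sym[OF \<tau>]]) (simp add: \<rho>(2) inv_inv_Sym[OF \<tau>])
    from imageI[OF this, of inv] show ?thesis by (simp only: inv_inv_Sym[OF \<tau>])
  qed
  then obtain X where X: "X \<subseteq> {1..n}" "inv ` F = (\<Union>x\<in>X. Star n c x)"
    "card (inv ` F) = card X * fact (n - 1)" by (rule Union_Star_if_determined_by_value[OF inv_F c])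
  have "F = inv ` inv ` F" by (simp add: image_image inv_inv)
  also have "\<dots> = (\<Union>x\<in>X. Star n x c)" by (simp add: X(2) image_UN inv_image_Star)
  finally have "F = (\<Union>x\<in>X. Star n x c)" .
  moreover have "inj_on inv F" by (rule inj_on_inverseI[where g = inv]) (rule inv_inv)
  then have "card (inv ` F) = card F" by (rule card_image)
  ultimately show thesis using that X(1,3) by simp
qed

theorem Union_Star_if_card_eq_nu_times_fact:
  assumes n: "6 \<le> n" and F: "F \<subseteq> Sym n" and card: "card F = nu n F * fact (n - 1)"
  shows "(\<exists>x\<in>{1..n}. \<exists>Y. Y \<subseteq> {1..n} \<and> card Y = nu n F \<and> F = (\<Union>y\<in>Y. Star n x y))
       \<or> (\<exists>y\<in>{1..n}. \<exists>X. X \<subseteq> {1..n} \<and> card X = nu n F \<and> F = (\<Union>x\<in>X. Star n x y))"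
proof -
  let ?f = "\<lambda>\<sigma>. of_bool (\<sigma> \<in> F) :: int"
  interpret swap_additive "{1..n}" ?f
    using n by (intro swap_additive_if_latin_constant latin_constant_of_extremal F card) simp_all
  have "?f \<sigma> \<in> {0, 1}" for \<sigma> by simp
  from boolean_dictator[OF this] consider
    (row) r where "r \<in> {1..n}"
      "\<forall>\<sigma> \<tau>. \<sigma> permutes {1..n} \<longrightarrow> \<tau> permutes {1..n} \<longrightarrow> \<sigma> r = \<tau> r \<longrightarrow> ?f \<sigma> = ?f \<tau>"
    | (column) c where "c \<in> {1..n}"
      "\<forall>\<sigma> \<tau>. \<sigma> permutes {1..n} \<longrightarrow> \<tau> permutes {1..n} \<longrightarrow> inv \<sigma> c = inv \<tau> c \<longrightarrow> ?f \<sigma> = ?f \<tau>"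
    by blast
  then show ?thesis
  proof cases
    case row
    have "\<tau> \<in> F" if "\<sigma> \<in> F" "\<tau> \<in> Sym n" "\<sigma> r = \<tau> r" for \<sigma> \<tau>
      using row(2)[rule_format, of \<sigma> \<tau>] F that by (simp add: Sym_def subset_iff)
    then obtain Y where Y: "Y \<subseteq> {1..n}" "F = (\<Union>y\<in>Y. Star n r y)" "card F = card Y * fact (n - 1)"
      by (rule Union_Star_if_determined_by_value[OF F row(1)])
    have "card Y = nu n F" using Y(3) card by simp
    then show ?thesis using Y(1,2) row(1) by blast
  next
    case column
    have "\<tau> \<in> F" if "\<sigma> \<in> F" "\<tau> \<in> Sym n" "inv \<sigma> c = inv \<tau> c" for \<sigma> \<tau>
      using column(2)[rule_format, of \<sigma> \<tau>] F that by (simp add: Sym_def subset_iff)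
    then obtain X where X: "X \<subseteq> {1..n}" "F = (\<Union>x\<in>X. Star n x c)" "card F = card X * fact (n - 1)"
      by (rule Union_Star_if_determined_by_position[OF F column(1)])
    have "card X = nu n F" using X(3) card by simp
    then show ?thesis using X(1,2) column(1) by blast
  qed
qed

lemma half_le_if_one_le_divide_ln:
  fixes n :: nat and c :: real
  assumes c: "0 < c" and le: "1 \<le> real n / (c * ln (real n))"
  shows "c / 2 \<le> real n"
proof -
  have "n \<noteq> 0" "n \<noteq> 1" using le by (intro notI; simp)+
  then have n: "2 \<le> real n" by linarith
  have "ln (1 / real n) \<le> 1 / real n - 1" using n by (intro ln_le_minus_one) simp
  moreover have "1 / real n \<le> 1 / 2" using n by simp
  moreover have "ln (1 / real n) = - ln (real n)" using n by (simp add: ln_div)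
  ultimately have ln: "1 / 2 \<le> ln (real n)" by linarith
  have "c / 2 \<le> c * ln (real n)" using mult_left_mono[OF ln, of c] c by simp
  also have "\<dots> \<le> real n" using le c ln by (simp add: le_divide_eq_1_pos)
  finally show ?thesis .
qed

theorem theorem4:
  fixes n s :: nat and F :: "(nat \<Rightarrow> nat) set"
  assumes "s \<ge> 2"
    and "real s \<le> real n / (2 ^ 17 * ln (real n))"
    and "F \<subseteq> Sym n"
    and "nu n F < s"
  shows "card F \<le> (s - 1) * fact (n - 1) \<and>
         (card F = (s - 1) * fact (n - 1) \<longrightarrow>
          ((\<exists>x\<in>{1..n}. \<exists>Y. Y \<subseteq> {1..n} \<and> card Y = s - 1 \<and> F = (\<Union>y\<in>Y. Star n x y))
         \<or> (\<exists>y\<in>{1..n}. \<exists>X. X \<subseteq> {1..n} \<and> card X = s - 1 \<and> F = (\<Union>x\<in>X. Star n x y))))"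
proof -
  have "2 ^ 17 / 2 \<le> real n"
    using assms(1,2) by (intro half_le_if_one_le_divide_ln) auto
  then have n: "6 \<le> n" by simp
  have bound: "card F \<le> nu n F * fact (n - 1)"
    using card_le_nu_times_fact[OF _ assms(3)] n by simp
  also have "\<dots> \<le> (s - 1) * fact (n - 1)" using assms(4) by simp
  finally have "card F \<le> (s - 1) * fact (n - 1)" .
  moreover have "nu n F = s - 1" if "card F = (s - 1) * fact (n - 1)"
    using bound assms(4) that by simp
  ultimately show ?thesis using Union_Star_if_card_eq_nu_times_fact[OF n assms(3)] by metis
qed

end
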